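(* Let $f=(f_1,\dots,f_g):\mathbb{R}^n\times\mathbb{R}^m\to\mathbb{R}^g$ be continuously differentiable in the box $\mathbf{\Omega}=\mathcal{X}\times\mathcal{U}\subset\mathbb{R}^n\times\mathbb{R}^m$. Then $f$ is locally Lipschitz continuous in $\mathbf{\Omega}$: for all $(x,u),(\hat x,u)\in\mathbf{\Omega}$ $$\|f(x,u)-f(\hat x,u)\|_2\le \gamma_{l_2}\,\|x-\hat x\|_2,$$ where $$\gamma_{l_2}=\Bigg(\sum_{i=1}^{g}\ \max_{(x,u)\in\mathbf{\Omega}}\|\nabla_x f_i(x,u)\|_2^2\Bigg)^{1/2}.$$
   Context: Standing assumptions: $\mathcal{X}\subset\mathbb{R}^n$ and $\mathcal{U}\subset\mathbb{R}^m$, and $\mathbf{\Omega}=\mathcal{X}\times\mathcal{U}$ is a nonempty box, i.e. a product of $n+m$ compact intervals $[\underline{\omega}_i,\overline{\omega}_i]$ with $\underline{\omega}_i,\overline{\omega}_i\in\mathbb{R}$; $f$ is of class $C^1$ in $\mathbf{\Omega}$ (differentiable at the points of $\mathbf{\Omega}$ with partial derivatives continuous on $\mathbf{\Omega}$). $\nabla_x f_i$ denotes the gradient of $f_i$ with respect to the first argument $x\in\mathbb{R}^n$ only; $\|\cdot\|_2$ is the Euclidean norm. *)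

theory Defs
  imports "HOL-Analysis.Analysis"
begin

definition partial_deriv :: "'a \<Rightarrow> ('a::euclidean_space \<Rightarrow> real) \<Rightarrow> 'a \<Rightarrow> real" where
  "partial_deriv b h p = deriv (\<lambda>t. h (p + t *\<^sub>R b)) 0"

text \<open>Differentiability is two-sided (in a neighbourhood in the whole space) also at the boundary
  points of \<open>S\<close>, so that all partial derivatives are determined even if \<open>S\<close> is a degenerate box.
  For a domain \<open>real ^ 'n \<times> real ^ 'm\<close>, \<^const>\<open>Basis\<close> consists of the coordinate directions
  of both factors.\<close>

definition C1_in :: "('a::euclidean_space \<Rightarrow> real ^ 'g) \<Rightarrow> 'a set \<Rightarrow> bool" where
  "C1_in f S \<longleftrightarrow>
     (\<forall>p\<in>S. f differentiable (at p)) \<and>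
     (\<forall>i. \<forall>b\<in>Basis. continuous_on S (partial_deriv b (\<lambda>p. f p $ i)))"

definition gradient :: "('a::real_inner \<Rightarrow> real) \<Rightarrow> 'a \<Rightarrow> 'a" where
  "gradient h x = (THE D. GDERIV h x :> D)"

definition grad_x :: "('a::real_inner \<times> 'b \<Rightarrow> real) \<Rightarrow> 'a \<times> 'b \<Rightarrow> 'a" where
  "grad_x h p = gradient (\<lambda>y. h (y, snd p)) (fst p)"

text \<open>The maximum itself, not the supremum: the value is only determined if it is attained on \<open>S\<close>.\<close>

definition max_over :: "'a set \<Rightarrow> ('a \<Rightarrow> real) \<Rightarrow> real" where
  "max_over S h = (GREATEST v. v \<in> h ` S)"

definition gamma_l2 ::
  "((real ^ 'n) \<times> (real ^ 'm) \<Rightarrow> real ^ 'g) \<Rightarrow> ((real ^ 'n) \<times> (real ^ 'm)) set \<Rightarrow> real" where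
  "gamma_l2 f \<Omega> =
     sqrt (\<Sum>i\<in>UNIV. max_over \<Omega> (\<lambda>p. (norm (grad_x (\<lambda>q. f q $ i) p))\<^sup>2))"

end

theory Submission
  imports Defs
begin

text \<open>Fix \<open>u\<close>. The slice \<open>X\<close> is a box, hence convex, so the mean
  value inequality bounds the change of each component of \<open>f\<close> in \<open>x\<close> by
  the largest norm of its x-gradient (\<open>grad_x_bound\<close>). Squaring these estimates and
  summing over the components gives the Euclidean bound with \<open>gamma_l2\<close>. The maxima in
  \<open>gamma_l2\<close> are genuine: the x-gradient is a combination of the continuous joint
  partial derivatives (\<open>grad_x_eq\<close>), so its squared norm attains its maximum on the
  compact box (\<open>max_over_ge\<close>). The resulting constant is global, so local Lipschitz
  continuity follows at once.\<close>

lemma gradient_eq: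
  assumes "GDERIV h x :> D"
  shows "gradient h x = D"
  unfolding gradient_def
proof (rule the_equality)
  fix D' assume "GDERIV h x :> D'"
  with assms have "(\<lambda>v. v \<bullet> D') = (\<lambda>v. v \<bullet> D)"
    unfolding gderiv_def by (rule has_derivative_unique[rotated])
  then show "D' = D"
    by (simp add: fun_eq_iff vector_eq_ldot)
qed (fact assms)

lemma partial_deriv_eq:
  assumes "(h has_derivative h') (at p)"
  shows "partial_deriv b h p = h' b"
proof -
  have "((\<lambda>t. p + t *\<^sub>R b) has_derivative (\<lambda>t. t *\<^sub>R b)) (at 0)"
    by (auto intro!: derivative_eq_intros)
  from has_derivative_compose[OF this, of h h'] assms
  have "((\<lambda>t. h (p + t *\<^sub>R b)) has_derivative (\<lambda>t. h' (t *\<^sub>R b))) (at 0)"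
    by simp
  moreover have "(\<lambda>t. h' (t *\<^sub>R b)) = (*) (h' b)"
    by (simp add: fun_eq_iff linear_scale[OF has_derivative_linear[OF assms]])
  ultimately have "((\<lambda>t. h (p + t *\<^sub>R b)) has_field_derivative h' b) (at 0)"
    by (simp add: has_field_derivative_def)
  then show ?thesis
    unfolding partial_deriv_def by (rule DERIV_imp_deriv)
qed

text \<open>The chain rule along \<open>y \<mapsto> (y, u)\<close> restricts the joint derivative to
  vectors \<open>(v, 0)\<close>, and linearity resolves it into partial derivatives. This links
  \<open>grad_x\<close> to the quantities whose continuity \<open>C1_in\<close> provides.\<close>

lemma gderiv_slice:
  fixes h :: "'a::euclidean_space \<times> 'b::euclidean_space \<Rightarrow> real"
  assumes "h differentiable (at (x, u))"
  shows "GDERIV (\<lambda>y. h (y, u)) x :> (\<Sum>b\<in>Basis. partial_deriv (b, 0) h (x, u) *\<^sub>R b)"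
proof -
  obtain h' where h': "(h has_derivative h') (at (x, u))"
    using assms by (auto simp: differentiable_def)
  have lin: "linear h'"
    using h' by (rule has_derivative_linear)
  have "((\<lambda>y. (y, u)) has_derivative (\<lambda>v. (v, 0))) (at x)"
    by (auto intro!: derivative_eq_intros)
  from has_derivative_compose[OF this h']
  have "((\<lambda>y. h (y, u)) has_derivative (\<lambda>v. h' (v, 0))) (at x)" .
  moreover have "h' (v, 0) = v \<bullet> (\<Sum>b\<in>Basis. partial_deriv (b, 0) h (x, u) *\<^sub>R b)" for v
  proof -
    have "(v, 0) = (\<Sum>b\<in>Basis. (v \<bullet> b) *\<^sub>R (b, 0::'b))"
      by (simp add: prod_eq_iff fst_sum snd_sum euclidean_representation)
    then have "h' (v, 0) = (\<Sum>b\<in>Basis. (v \<bullet> b) * h' (b, 0))"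
      by (simp add: linear_sum[OF lin] linear_scale[OF lin] del: scaleR_Pair)
    then show ?thesis
      by (simp add: inner_sum_right partial_deriv_eq[OF h'] mult.commute)
  qed
  ultimately show ?thesis
    by (simp add: gderiv_def)
qed

lemma grad_x_eq:
  fixes h :: "'a::euclidean_space \<times> 'b::euclidean_space \<Rightarrow> real"
  assumes "h differentiable (at p)"
  shows "grad_x h p = (\<Sum>b\<in>Basis. partial_deriv (b, 0) h p *\<^sub>R b)"
  using gradient_eq[OF gderiv_slice, of h "fst p" "snd p"] assms by (simp add: grad_x_def)

text \<open>Compactness and continuity supply a maximiser, without which the \<open>GREATEST\<close>
  in \<open>max_over\<close> would be undetermined.\<close>

lemma max_over_ge:
  assumes "compact S" "continuous_on S h" "p \<in> S"
  shows "h p \<le> max_over S h"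
proof -
  obtain q where q: "q \<in> S" "\<And>y. y \<in> S \<Longrightarrow> h y \<le> h q"
    using continuous_attains_sup[of S h] assms by auto
  then have "max_over S h = h q"
    unfolding max_over_def by (intro Greatest_equality) auto
  with q assms show ?thesis
    by simp
qed

text \<open>Mean value inequality on a convex slice: by Cauchy-Schwarz the operator norm of
  \<open>v \<mapsto> v \<bullet> D\<close> is at most the norm of \<open>D\<close>.\<close>

lemma grad_x_bound:
  fixes h :: "'a::euclidean_space \<times> 'b::euclidean_space \<Rightarrow> real"
  assumes "convex X"
    and diff: "\<And>x. x \<in> X \<Longrightarrow> h differentiable (at (x, u))"
    and bound: "\<And>x. x \<in> X \<Longrightarrow> norm (grad_x h (x, u)) \<le> B"
    and "x \<in> X" "x' \<in> X"
  shows "\<bar>h (x, u) - h (x', u)\<bar> \<le> B * norm (x - x')"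
proof -
  have "norm (h (x, u) - h (x', u)) \<le> B * norm (x - x')"
  proof (rule differentiable_bound[OF \<open>convex X\<close>])
    fix y assume "y \<in> X"
    then show "((\<lambda>y. h (y, u)) has_derivative (\<lambda>v. v \<bullet> grad_x h (y, u))) (at y within X)"
      using gderiv_slice[OF diff] grad_x_eq[OF diff]
      by (simp add: gderiv_def has_derivative_at_withinI)
    show "onorm (\<lambda>v. v \<bullet> grad_x h (y, u)) \<le> B"
    proof (rule onorm_le)
      fix v
      have "norm (v \<bullet> grad_x h (y, u)) \<le> norm v * norm (grad_x h (y, u))"
        by (simp add: Cauchy_Schwarz_ineq2)
      also have "\<dots> \<le> norm v * B"
        using bound \<open>y \<in> X\<close> by (simp add: mult_left_mono)
      finally show "norm (v \<bullet> grad_x h (y, u)) \<le> B * norm v"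
        by (simp add: mult.commute)
    qed
  qed (use assms in auto)
  then show ?thesis
    by simp
qed

theorem corollary1:
  fixes f :: "(real ^ 'n) \<times> (real ^ 'm) \<Rightarrow> real ^ 'g"
    and X :: "(real ^ 'n) set" and U :: "(real ^ 'm) set"
    and xl xu :: "real ^ 'n" and ul uu :: "real ^ 'm"
  assumes X: "X = cbox xl xu" and U: "U = cbox ul uu"
    and nonempty: "X \<times> U \<noteq> {}"
    and C1: "C1_in f (X \<times> U)"
  shows "local_lipschitz U X (\<lambda>u x. f (x, u)) \<and>
    (\<forall>x x' u. (x, u) \<in> X \<times> U \<longrightarrow> (x', u) \<in> X \<times> U \<longrightarrow>
       norm (f (x, u) - f (x', u)) \<le> gamma_l2 f (X \<times> U) * norm (x - x'))"
proof -
  let ?\<Omega> = "X \<times> U"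
  define M where "M i = max_over ?\<Omega> (\<lambda>p. (norm (grad_x (\<lambda>q. f q $ i) p))\<^sup>2)" for i
  have gamma: "gamma_l2 f ?\<Omega> = sqrt (\<Sum>i\<in>UNIV. M i)"
    by (simp add: gamma_l2_def M_def)
  have diff: "(\<lambda>q. f q $ i) differentiable (at p)" if "p \<in> ?\<Omega>" for i p
    using C1 that bounded_linear.has_derivative[OF bounded_linear_vec_nth]
    unfolding C1_in_def differentiable_def by blast
  have grad_le: "(norm (grad_x (\<lambda>q. f q $ i) p))\<^sup>2 \<le> M i" if "p \<in> ?\<Omega>" for i p
    unfolding M_def
  proof (rule max_over_ge[OF _ _ that])
    show "compact ?\<Omega>"
      by (simp add: X U compact_Times)
    \<comment> \<open>Each \<open>(b, 0)\<close> is a basis vector of the product space, so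
      \<open>C1_in\<close> applies to it.\<close>
    have "continuous_on ?\<Omega> (partial_deriv (b, 0) (\<lambda>q. f q $ i))" if "b \<in> Basis" for b
      using C1 that by (simp add: C1_in_def Basis_prod_def)
    then have "continuous_on ?\<Omega> (\<lambda>p. \<Sum>b\<in>Basis. partial_deriv (b, 0) (\<lambda>q. f q $ i) p *\<^sub>R b)"
      by (intro continuous_intros) auto
    then have "continuous_on ?\<Omega> (grad_x (\<lambda>q. f q $ i))"
      by (rule continuous_on_eq) (simp only: grad_x_eq[OF diff])
    then show "continuous_on ?\<Omega> (\<lambda>p. (norm (grad_x (\<lambda>q. f q $ i) p))\<^sup>2)"
      by (intro continuous_intros)
  qed
  \<comment> \<open>A point of the nonempty domain puts a squared norm below \<open>M i\<close>. The
    sign is what lets \<open>(sqrt (M i))\<^sup>2\<close> collapse to \<open>M i\<close> and makes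
    \<open>gamma_l2\<close> an admissible Lipschitz constant.\<close>
  have M_nonneg: "0 \<le> M i" for i
  proof -
    obtain p where "p \<in> ?\<Omega>"
      using nonempty by blast
    with grad_le[of p i] show ?thesis
      by (meson order_trans zero_le_power2)
  qed
  have bound: "norm (f (x, u) - f (x', u)) \<le> gamma_l2 f ?\<Omega> * norm (x - x')"
    if "x \<in> X" "x' \<in> X" "u \<in> U" for x x' u
  proof -
    \<comment> \<open>The componentwise bounds are squared because the squared Euclidean norm is
      their sum, which yields the sum of the \<open>M i\<close> under the root.\<close>
    have comp: "(f (x, u) $ i - f (x', u) $ i)\<^sup>2 \<le> M i * (norm (x - x'))\<^sup>2" for i
    proof -
      have "\<bar>f (x, u) $ i - f (x', u) $ i\<bar> \<le> sqrt (M i) * norm (x - x')"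
        by (rule grad_x_bound[where X = X and h = "\<lambda>q. f q $ i"])
          (use that diff grad_le in \<open>auto simp: X intro!: real_le_rsqrt\<close>)
      then have "\<bar>f (x, u) $ i - f (x', u) $ i\<bar>\<^sup>2 \<le> (sqrt (M i) * norm (x - x'))\<^sup>2"
        by (intro power_mono) auto
      then show ?thesis
        by (simp add: power_mult_distrib M_nonneg)
    qed
    have "(norm (f (x, u) - f (x', u)))\<^sup>2 = (\<Sum>i\<in>UNIV. (f (x, u) $ i - f (x', u) $ i)\<^sup>2)"
      by (simp add: norm_vec_def L2_set_def sum_nonneg)
    also have "\<dots> \<le> (\<Sum>i\<in>UNIV. M i) * (norm (x - x'))\<^sup>2"
      unfolding sum_distrib_right by (intro sum_mono comp)
    finally have "norm (f (x, u) - f (x', u)) \<le> sqrt ((\<Sum>i\<in>UNIV. M i) * (norm (x - x'))\<^sup>2)"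
      by (rule real_le_rsqrt)
    then show ?thesis
      by (simp add: gamma real_sqrt_mult)
  qed
  have "local_lipschitz U X (\<lambda>u x. f (x, u))"
  proof (rule local_lipschitzI)
    fix u x assume "u \<in> U" "x \<in> X"
    \<comment> \<open>The radius 1 is arbitrary, since the constant serves on all of
      \<open>X\<close> and for every \<open>t\<close> in \<open>U\<close>.\<close>
    have "(gamma_l2 f ?\<Omega>)-lipschitz_on (cball x 1 \<inter> X) (\<lambda>x. f (x, t))" if "t \<in> U" for t
      by (rule lipschitz_onI) (use that bound in \<open>auto simp: dist_norm gamma sum_nonneg M_nonneg\<close>)
    then show "\<exists>e>0. \<exists>L. \<forall>t\<in>cball u e \<inter> U. L-lipschitz_on (cball x e \<inter> X) (\<lambda>x. f (x, t))"
      by (intro exI[of _ 1]) auto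
  qed
  with bound show ?thesis
    by auto
qed

end
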